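(* Let $Y_1$ and $Y_2$ be two $3$-manifolds with torus boundary, let $\varphi\colon\partial Y_1\to\partial Y_2$ be a diffeomorphism, let $Y=Y_1\cup_\varphi Y_2$ and let $\Sigma\subset Y$ be the embedded torus corresponding to $\partial Y_1=\partial Y_2$. Then $Y$ is $SU(2)$-abelian if and only if every representation $\rho\colon\pi_1(Y)\to SU(2)$ whose restriction to $\pi_1(\Sigma)$ lies in $T(Y_1,\Sigma)\cap T(Y_2,\Sigma)$ has abelian image.
   Context: $U(1)\subset SU(2)$ denotes the subgroup of diagonal matrices. A $3$-manifold is $SU(2)$-abelian if every homomorphism from its fundamental group to $SU(2)$ has abelian image. For a $3$-manifold $Y$ and a torus $\Sigma$ embedded in $Y$ (in particular a boundary torus), $T(Y,\Sigma)\subseteq\mathrm{Hom}(\pi_1(\Sigma),U(1))$ is the set of representations $\pi_1(\Sigma)\to U(1)$ that extend, via the inclusion-induced map, to a representation $\pi_1(Y)\to SU(2)$. With $\Sigma=\partial Y_1=\partial Y_2$, both $T(Y_1,\Sigma)$ and $T(Y_2,\Sigma)$ are subsets of $\mathrm{Hom}(\pi_1(\Sigma),U(1))$. Base points are taken on $\Sigma$. *)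

theory Defs
  imports "HOL-Analysis.Analysis" "HOL-Algebra.Group"
begin

section \<open>Smooth manifolds with boundary\<close>

text \<open>\<open>Ck_on n f S\<close> is meant for open \<open>S\<close>: it says that \<open>f\<close> is of class \<open>C\<^sup>n\<close> on \<open>S\<close>.\<close>

primrec Ck_on :: "nat \<Rightarrow> ('e::euclidean_space \<Rightarrow> 'f::euclidean_space) \<Rightarrow> 'e set \<Rightarrow> bool" where
  "Ck_on 0 f S \<longleftrightarrow> continuous_on S f"
| "Ck_on (Suc n) f S \<longleftrightarrow> (\<forall>x\<in>S. f differentiable (at x)) \<and>
     (\<forall>v. Ck_on n (\<lambda>x. frechet_derivative f (at x) v) S)"

text \<open>Smoothness on an arbitrary subset of a Euclidean space (in particular on a relatively open
  subset of a half-space): local existence of smooth extensions to open sets.\<close>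

definition smooth_on :: "'e::euclidean_space set \<Rightarrow> ('e \<Rightarrow> 'f::euclidean_space) \<Rightarrow> bool" where
  "smooth_on S f \<longleftrightarrow> (\<forall>x\<in>S. \<exists>W g. open W \<and> x \<in> W \<and> (\<forall>n. Ck_on n g W) \<and> (\<forall>y\<in>S \<inter> W. g y = f y))"

text \<open>A chart is a pair of its domain and its coordinate map.\<close>

type_synonym ('a, 'e) chart = "'a set \<times> ('a \<Rightarrow> 'e)"

text \<open>\<open>M\<close> is the local model: a half-space, or the whole Euclidean space if there is no boundary.
  Atlases are not required to be maximal.\<close>

definition smooth_atlas :: "'e::euclidean_space set \<Rightarrow> 'a topology \<Rightarrow> ('a, 'e) chart set \<Rightarrow> bool" where
  "smooth_atlas M X \<A> \<longleftrightarrow>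
     (\<Union>(U, c)\<in>\<A>. U) = topspace X \<and>
     (\<forall>(U, c)\<in>\<A>. openin X U \<and> openin (top_of_set M) (c ` U) \<and>
        homeomorphic_map (subtopology X U) (top_of_set (c ` U)) c) \<and>
     (\<forall>(U, c)\<in>\<A>. \<forall>(V, d)\<in>\<A>. smooth_on (c ` (U \<inter> V)) (d \<circ> inv_into U c))"

definition smooth_manifold :: "'e::euclidean_space set \<Rightarrow> 'a topology \<Rightarrow> ('a, 'e) chart set \<Rightarrow> bool" where
  "smooth_manifold M X \<A> \<longleftrightarrow> Hausdorff_space X \<and> second_countable X \<and> smooth_atlas M X \<A>"

definition smooth_map ::
  "'a topology \<Rightarrow> ('a, 'e::euclidean_space) chart set \<Rightarrow>
   'b topology \<Rightarrow> ('b, 'f::euclidean_space) chart set \<Rightarrow> ('a \<Rightarrow> 'b) \<Rightarrow> bool" where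
  "smooth_map X \<A> Y \<B> f \<longleftrightarrow> continuous_map X Y f \<and>
     (\<forall>(U, c)\<in>\<A>. \<forall>(V, d)\<in>\<B>. smooth_on (c ` {x \<in> U. f x \<in> V}) (d \<circ> f \<circ> inv_into U c))"

definition diffeomorphism ::
  "'a topology \<Rightarrow> ('a, 'e::euclidean_space) chart set \<Rightarrow>
   'b topology \<Rightarrow> ('b, 'f::euclidean_space) chart set \<Rightarrow> ('a \<Rightarrow> 'b) \<Rightarrow> bool" where
  "diffeomorphism X \<A> Y \<B> f \<longleftrightarrow>
     (\<exists>g. smooth_map X \<A> Y \<B> f \<and> smooth_map Y \<B> X \<A> g \<and>
          (\<forall>x\<in>topspace X. g (f x) = x) \<and> (\<forall>y\<in>topspace Y. f (g y) = y))"

definition half_space :: "(real^3) set" where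
  "half_space = {v. 0 \<le> v $ 1}"

definition bd :: "('a, real^3) chart set \<Rightarrow> 'a set" where
  "bd \<A> = (\<Union>(U, c)\<in>\<A>. {x \<in> U. c x $ 1 = 0})"

text \<open>The induced atlas on the boundary: restrict charts and drop the vanishing coordinate.\<close>

definition bd_atlas :: "('a, real^3) chart set \<Rightarrow> ('a, real^2) chart set" where
  "bd_atlas \<A> = (\<lambda>(U, c). (U \<inter> bd \<A>, \<lambda>x. vector [c x $ 2, c x $ 3])) ` \<A>"

definition bd_space :: "'a topology \<Rightarrow> ('a, real^3) chart set \<Rightarrow> 'a topology" where
  "bd_space X \<A> = subtopology X (bd \<A>)"

definition torus :: "(complex \<times> complex) topology" where
  "torus = prod_topology (top_of_set (sphere 0 1)) (top_of_set (sphere 0 1))"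

text \<open>Manifolds are connected; neither compactness nor orientability is required.\<close>

definition three_manifold_with_torus_boundary :: "'a topology \<Rightarrow> ('a, real^3) chart set \<Rightarrow> bool" where
  "three_manifold_with_torus_boundary X \<A> \<longleftrightarrow>
     smooth_manifold half_space X \<A> \<and> connected_space X \<and> bd_space X \<A> homeomorphic_space torus"


section \<open>Gluing two spaces\<close>

text \<open>The equivalence relation on the disjoint union generated by \<open>x \<sim> \<phi> x\<close> for \<open>x \<in> B\<close>.\<close>

definition glue_rel :: "'a set \<Rightarrow> ('a \<Rightarrow> 'b) \<Rightarrow> ('a + 'b) rel" where
  "glue_rel B \<phi> = (let r = {(Inl x, Inr (\<phi> x)) | x. x \<in> B} in (r \<union> r\<inverse>)\<^sup>*)"

text \<open>The canonical maps from the two pieces to the glued space.\<close>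

definition glue_left :: "'a set \<Rightarrow> ('a \<Rightarrow> 'b) \<Rightarrow> 'a \<Rightarrow> ('a + 'b) set" where
  "glue_left B \<phi> x = glue_rel B \<phi> `` {Inl x}"

definition glue_right :: "'a set \<Rightarrow> ('a \<Rightarrow> 'b) \<Rightarrow> 'b \<Rightarrow> ('a + 'b) set" where
  "glue_right B \<phi> y = glue_rel B \<phi> `` {Inr y}"

text \<open>The quotient of the disjoint union \<open>X + Y\<close> by \<open>glue_rel B \<phi>\<close>, with the quotient topology.\<close>

definition glue :: "'a topology \<Rightarrow> 'a set \<Rightarrow> ('a \<Rightarrow> 'b) \<Rightarrow> 'b topology \<Rightarrow> ('a + 'b) set topology" where
  "glue X B \<phi> Y = topology (\<lambda>U.
     U \<subseteq> glue_left B \<phi> ` topspace X \<union> glue_right B \<phi> ` topspace Y \<and>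
     openin X {x \<in> topspace X. glue_left B \<phi> x \<in> U} \<and>
     openin Y {y \<in> topspace Y. glue_right B \<phi> y \<in> U})"

lemma openin_glue:
  "openin (glue X B \<phi> Y) U \<longleftrightarrow>
     U \<subseteq> glue_left B \<phi> ` topspace X \<union> glue_right B \<phi> ` topspace Y \<and>
     openin X {x \<in> topspace X. glue_left B \<phi> x \<in> U} \<and>
     openin Y {y \<in> topspace Y. glue_right B \<phi> y \<in> U}"
proof -
  have 1: "{x \<in> topspace Z. f x \<in> S \<inter> T} = {x \<in> topspace Z. f x \<in> S} \<inter> {x \<in> topspace Z. f x \<in> T}"
    for Z :: "'z topology" and f :: "'z \<Rightarrow> ('a + 'b) set" and S T by auto
  have 2: "{x \<in> topspace Z. f x \<in> \<Union>\<K>} = (\<Union>S\<in>\<K>. {x \<in> topspace Z. f x \<in> S})"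
    for Z :: "'z topology" and f :: "'z \<Rightarrow> ('a + 'b) set" and \<K> by auto
  have "istopology (\<lambda>U.
     U \<subseteq> glue_left B \<phi> ` topspace X \<union> glue_right B \<phi> ` topspace Y \<and>
     openin X {x \<in> topspace X. glue_left B \<phi> x \<in> U} \<and>
     openin Y {y \<in> topspace Y. glue_right B \<phi> y \<in> U})"
    unfolding istopology_def 1 2 by (auto intro!: openin_Union)
  then show ?thesis
    by (simp add: glue_def topology_inverse')
qed

lemma topspace_glue:
  "topspace (glue X B \<phi> Y) = glue_left B \<phi> ` topspace X \<union> glue_right B \<phi> ` topspace Y"
proof (rule antisym)
  show "topspace (glue X B \<phi> Y) \<subseteq> glue_left B \<phi> ` topspace X \<union> glue_right B \<phi> ` topspace Y"
    using openin_topspace openin_glue by blast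
  have "{x \<in> topspace X. glue_left B \<phi> x \<in> glue_left B \<phi> ` topspace X \<union> glue_right B \<phi> ` topspace Y}
      = topspace X"
    "{y \<in> topspace Y. glue_right B \<phi> y \<in> glue_left B \<phi> ` topspace X \<union> glue_right B \<phi> ` topspace Y}
      = topspace Y" by auto
  then have "openin (glue X B \<phi> Y) (glue_left B \<phi> ` topspace X \<union> glue_right B \<phi> ` topspace Y)"
    by (simp add: openin_glue)
  then show "glue_left B \<phi> ` topspace X \<union> glue_right B \<phi> ` topspace Y \<subseteq> topspace (glue X B \<phi> Y)"
    by (rule openin_subset)
qed

lemma glue_rel_inj:
  assumes "inj_on \<phi> B"
  shows "glue_rel B \<phi> = Id \<union> {(Inl x, Inr (\<phi> x)) | x. x \<in> B} \<union> {(Inr (\<phi> x), Inl x) | x. x \<in> B}"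
    (is "_ = ?E")
proof -
  let ?r = "{(Inl x, Inr (\<phi> x)) | x. x \<in> B}"
  have "(z, w) \<in> ?E" if "(z, w) \<in> (?r \<union> ?r\<inverse>)\<^sup>*" for z w
    using that by (induction rule: rtrancl_induct) (use assms in \<open>auto simp: inj_on_def\<close>)
  then have "(?r \<union> ?r\<inverse>)\<^sup>* \<subseteq> ?E" by (rule subrelI)
  moreover have "?E \<subseteq> (?r \<union> ?r\<inverse>)\<^sup>*"
  proof -
    have "?E = Id \<union> (?r \<union> ?r\<inverse>)" by blast
    moreover have "Id \<subseteq> (?r \<union> ?r\<inverse>)\<^sup>*" by auto
    moreover have "?r \<union> ?r\<inverse> \<subseteq> (?r \<union> ?r\<inverse>)\<^sup>*" by (rule subrelI) (rule r_into_rtrancl)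
    ultimately show ?thesis by (simp only: Un_least)
  qed
  ultimately show ?thesis
    unfolding glue_rel_def Let_def by (rule equalityI)
qed

lemma glue_left_inj:
  assumes "inj_on \<phi> B"
  shows "glue_left B \<phi> x = insert (Inl x) (if x \<in> B then {Inr (\<phi> x)} else {})"
  unfolding glue_left_def glue_rel_inj[OF assms] by auto

lemma glue_right_inj:
  assumes "inj_on \<phi> B"
  shows "glue_right B \<phi> y = insert (Inr y) (Inl ` {x \<in> B. \<phi> x = y})"
  unfolding glue_right_def glue_rel_inj[OF assms] by auto

lemma glue_left_right:
  assumes "inj_on \<phi> B" "x \<in> B"
  shows "glue_left B \<phi> x = glue_right B \<phi> (\<phi> x)"
proof -
  have "{x' \<in> B. \<phi> x' = \<phi> x} = {x}"
    using assms by (auto simp: inj_on_def)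
  then show ?thesis
    using assms(2) by (simp add: glue_left_inj[OF assms(1)] glue_right_inj[OF assms(1)] insert_commute)
qed

text \<open>Both pieces embed into the glued space, so they may be identified with their images there.\<close>

lemma embedding_map_glue:
  assumes \<phi>: "homeomorphic_map (subtopology X B) (subtopology Y C) \<phi>"
    and B: "closedin X B" and C: "closedin Y C"
  shows "embedding_map X (glue X B \<phi> Y) (glue_left B \<phi>)"
    and "embedding_map Y (glue X B \<phi> Y) (glue_right B \<phi>)"
proof -
  let ?l = "glue_left B \<phi>" and ?r = "glue_right B \<phi>" and ?Z = "glue X B \<phi> Y"
  have BC: "B \<subseteq> topspace X" "C \<subseteq> topspace Y"
    using B C closedin_subset by auto
  then have inj: "inj_on \<phi> B" and im: "\<phi> ` B = C"
    using homeomorphic_imp_injective_map[OF \<phi>] homeomorphic_imp_surjective_map[OF \<phi>]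
    by (simp_all add: Int_absorb1)
  have ll: "?l x = ?l x' \<longleftrightarrow> x = x'" for x x'
    by (auto simp: glue_left_inj[OF inj] split: if_splits)
  have rr: "?r y = ?r y' \<longleftrightarrow> y = y'" for y y'
    by (auto simp: glue_right_inj[OF inj])
  have lr: "?l x = ?r y \<longleftrightarrow> x \<in> B \<and> y = \<phi> x" for x y
  proof
    assume "?l x = ?r y"
    then have "Inr y \<in> ?l x" by (simp add: glue_right_inj[OF inj])
    then show "x \<in> B \<and> y = \<phi> x" by (auto simp: glue_left_inj[OF inj] split: if_splits)
  qed (use glue_left_right[OF inj] in auto)
  have cl: "closedin ?Z K" if "K \<subseteq> topspace ?Z" "closedin X {x \<in> topspace X. ?l x \<in> K}"
    "closedin Y {y \<in> topspace Y. ?r y \<in> K}" for K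
  proof -
    have "{x \<in> topspace X. ?l x \<in> topspace ?Z - K} = topspace X - {x \<in> topspace X. ?l x \<in> K}"
      "{y \<in> topspace Y. ?r y \<in> topspace ?Z - K} = topspace Y - {y \<in> topspace Y. ?r y \<in> K}"
      by (auto simp: topspace_glue)
    then have "openin ?Z (topspace ?Z - K)"
      using that by (auto simp: openin_glue topspace_glue)
    with that show ?thesis by (simp add: closedin_def)
  qed
  have "continuous_map X ?Z ?l" "continuous_map Y ?Z ?r"
    by (auto simp: continuous_map_def topspace_glue openin_glue)
  moreover have "closed_map X ?Z ?l"
    unfolding closed_map_def
  proof (intro allI impI cl)
    fix K assume K: "closedin X K"
    then have KX: "K \<subseteq> topspace X" by (rule closedin_subset)
    show "?l ` K \<subseteq> topspace ?Z" using KX by (auto simp: topspace_glue)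
    have "{x \<in> topspace X. ?l x \<in> ?l ` K} = K" using KX by (auto simp: ll)
    with K show "closedin X {x \<in> topspace X. ?l x \<in> ?l ` K}" by simp
    have "{y \<in> topspace Y. ?r y \<in> ?l ` K} = \<phi> ` (K \<inter> B)"
    proof (intro equalityI subsetI)
      fix y assume "y \<in> {y \<in> topspace Y. ?r y \<in> ?l ` K}"
      then obtain k where "k \<in> K" "?l k = ?r y" by auto
      then show "y \<in> \<phi> ` (K \<inter> B)" by (auto simp: lr)
    next
      fix y assume "y \<in> \<phi> ` (K \<inter> B)"
      then obtain k where k: "k \<in> K" "k \<in> B" "y = \<phi> k" by auto
      then have "?l k = ?r y" by (simp add: lr)
      then have "?r y \<in> ?l ` K" using k(1) by (metis imageI)
      moreover have "y \<in> topspace Y" using k im BC by auto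
      ultimately show "y \<in> {y \<in> topspace Y. ?r y \<in> ?l ` K}" by simp
    qed
    moreover have "closedin (subtopology Y C) (\<phi> ` (K \<inter> B))"
    proof -
      have "closedin (subtopology X B) (K \<inter> B)" using K by (auto simp: closedin_subtopology)
      then show ?thesis using homeomorphic_imp_closed_map[OF \<phi>] by (simp add: closed_map_def)
    qed
    ultimately show "closedin Y {y \<in> topspace Y. ?r y \<in> ?l ` K}"
      using C by (simp add: closedin_trans_full)
  qed
  moreover have "closed_map Y ?Z ?r"
    unfolding closed_map_def
  proof (intro allI impI cl)
    fix K assume K: "closedin Y K"
    then have KY: "K \<subseteq> topspace Y" by (rule closedin_subset)
    show "?r ` K \<subseteq> topspace ?Z" using KY by (auto simp: topspace_glue)
    have "{y \<in> topspace Y. ?r y \<in> ?r ` K} = K" using KY by (auto simp: rr)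
    with K show "closedin Y {y \<in> topspace Y. ?r y \<in> ?r ` K}" by simp
    have "{x \<in> topspace X. ?l x \<in> ?r ` K} = {x \<in> topspace (subtopology X B). \<phi> x \<in> K \<inter> C}"
      using im BC by (auto simp: lr image_iff)
    moreover have "closedin (subtopology X B) {x \<in> topspace (subtopology X B). \<phi> x \<in> K \<inter> C}"
    proof -
      have "closedin (subtopology Y C) (K \<inter> C)" using K by (auto simp: closedin_subtopology)
      then show ?thesis
        by (rule closedin_continuous_map_preimage[OF homeomorphic_imp_continuous_map[OF \<phi>]])
    qed
    ultimately show "closedin X {x \<in> topspace X. ?l x \<in> ?r ` K}"
      using B by (simp add: closedin_trans_full)
  qed
  moreover have "inj_on ?l (topspace X)" "inj_on ?r (topspace Y)"
    by (auto simp: inj_on_def ll rr)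
  ultimately show "embedding_map X ?Z ?l" "embedding_map Y ?Z ?r"
    by (simp_all add: injective_closed_imp_embedding_map)
qed


section \<open>The fundamental group\<close>

text \<open>As in \<^const>\<open>pathin\<close>, only the values of a loop on \<open>{0..1}\<close> matter, but loops are total
  functions.\<close>

definition loops :: "'a topology \<Rightarrow> 'a \<Rightarrow> (real \<Rightarrow> 'a) set" where
  "loops X x = {p. pathin X p \<and> p 0 = x \<and> p 1 = x}"

definition loop_class :: "'a topology \<Rightarrow> 'a \<Rightarrow> (real \<Rightarrow> 'a) \<Rightarrow> (real \<Rightarrow> 'a) set" where
  "loop_class X x p = {q. homotopic_with (\<lambda>r. r 0 = x \<and> r 1 = x) (top_of_set {0..1}) X p q}"

definition loop_join :: "(real \<Rightarrow> 'a) \<Rightarrow> (real \<Rightarrow> 'a) \<Rightarrow> real \<Rightarrow> 'a" where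
  "loop_join p q = (\<lambda>t. if t \<le> 1/2 then p (2 * t) else q (2 * t - 1))"

text \<open>In the product, all the classes in the union coincide.\<close>

definition pi1 :: "'a topology \<Rightarrow> 'a \<Rightarrow> (real \<Rightarrow> 'a) set monoid" where
  "pi1 X x = \<lparr>carrier = loop_class X x ` loops X x,
     mult = (\<lambda>a b. \<Union>p\<in>a. \<Union>q\<in>b. loop_class X x (loop_join p q)),
     one = loop_class X x (\<lambda>_. x)\<rparr>"

text \<open>The map \<open>\<pi>\<^sub>1(S, x) \<rightarrow> \<pi>\<^sub>1(X, x)\<close> induced by the inclusion of a subspace \<open>S\<close> of \<open>X\<close>.\<close>

definition pi1_incl :: "'a topology \<Rightarrow> 'a \<Rightarrow> (real \<Rightarrow> 'a) set \<Rightarrow> (real \<Rightarrow> 'a) set" where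
  "pi1_incl X x a = (\<Union>p\<in>a. loop_class X x p)"


section \<open>Representations\<close>

definition conj_transpose :: "complex^'n^'m \<Rightarrow> complex^'m^'n" where
  "conj_transpose A = (\<chi> i j. cnj (A $ j $ i))"

definition SU2 :: "(complex^2^2) monoid" where
  "SU2 = \<lparr>carrier = {A. A ** conj_transpose A = mat 1 \<and> det A = 1}, mult = (**), one = mat 1\<rparr>"

definition U1 :: "(complex^2^2) monoid" where
  "U1 = SU2\<lparr>carrier := {A \<in> carrier SU2. \<forall>i j. i \<noteq> j \<longrightarrow> A $ i $ j = 0}\<rparr>"

definition abelian_image :: "('g, 'm) monoid_scheme \<Rightarrow> ('g \<Rightarrow> complex^2^2) \<Rightarrow> bool" where
  "abelian_image G \<rho> \<longleftrightarrow> (\<forall>A\<in>\<rho> ` carrier G. \<forall>B\<in>\<rho> ` carrier G. A \<otimes>\<^bsub>SU2\<^esub> B = B \<otimes>\<^bsub>SU2\<^esub> A)"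

text \<open>For a path connected space the choice of the base point is irrelevant.\<close>

definition SU2_abelian :: "'a topology \<Rightarrow> bool" where
  "SU2_abelian X \<longleftrightarrow> (\<forall>x\<in>topspace X. \<forall>\<rho>\<in>hom (pi1 X x) SU2. abelian_image (pi1 X x) \<rho>)"

text \<open>Elements of \<^const>\<open>hom\<close> are total functions; \<open>T_set X S x\<close> only depends on their values
  on the carrier.\<close>

definition T_set :: "'a topology \<Rightarrow> 'a set \<Rightarrow> 'a \<Rightarrow> ((real \<Rightarrow> 'a) set \<Rightarrow> complex^2^2) set" where
  "T_set X S x = {\<rho> \<in> hom (pi1 (subtopology X S) x) U1.
     \<exists>\<sigma>\<in>hom (pi1 X x) SU2. \<forall>g\<in>carrier (pi1 (subtopology X S) x). \<sigma> (pi1_incl X x g) = \<rho> g}"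

end

theory Submission
  imports Defs
begin

text \<open>
If \<open>Y\<close> is \<open>SU(2)\<close>-abelian, there is nothing to show. Conversely, let every representation of
\<open>\<pi>\<^sub>1(Y, x)\<close> whose restriction to the torus is diagonal and extends over both pieces have abelian
image. An arbitrary representation \<open>\<rho>\<close> becomes one of these after a conjugation. The fundamental
group of a torus is abelian, so \<open>\<rho>\<close> maps it to commuting matrices in \<open>SU(2)\<close>, and these can be
diagonalized simultaneously by some \<open>P\<close> in \<open>SU(2)\<close>
(\<open>commuting_SU2_simultaneously_diagonalizable\<close>). The restriction of \<open>P\<inverse> \<rho> P\<close> to the torus then has
values in \<open>U(1)\<close>, and it extends over each piece because \<open>P\<inverse> \<rho> P\<close> is defined on all of
\<open>\<pi>\<^sub>1(Y, x)\<close>. So \<open>P\<inverse> \<rho> P\<close> has abelian image, and hence so has \<open>\<rho>\<close>. This works for any torus in a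
path connected space and any two subspaces that contain it
(\<open>SU2_abelian_of_torus_reps_abelian\<close>).

Two topological inputs remain. The notion of being \<open>SU(2)\<close>-abelian refers to every base point, while
the criterion uses one on the torus, so \<open>Y\<close> has to be path connected: connected manifolds
are path connected, and the two pieces meet. The image of the boundary in \<open>Y\<close> has to be a torus in
the subspace topology: this holds because the pieces embed into \<open>Y\<close> as soon as their boundaries are
closed, which compactness of the torus gives. The group laws and the commutativity come from one
principle: a continuous map on a convex set takes any two paths with common ends to homotopic paths
(\<open>path_homotopic_convex\<close>).
\<close>

section \<open>Homotopy of paths relative to their ends\<close>

abbreviation path_homotopic :: "'a topology \<Rightarrow> 'a \<Rightarrow> 'a \<Rightarrow> (real \<Rightarrow> 'a) \<Rightarrow> (real \<Rightarrow> 'a) \<Rightarrow> bool" where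
  "path_homotopic X a b \<equiv> homotopic_with (\<lambda>r. r 0 = a \<and> r 1 = b) (top_of_set {0..1}) X"

definition paths_between :: "'a topology \<Rightarrow> 'a \<Rightarrow> 'a \<Rightarrow> (real \<Rightarrow> 'a) set" where
  "paths_between X a b = {p. pathin X p \<and> p 0 = a \<and> p 1 = b}"

lemma loops_eq_paths_between: "loops X x = paths_between X x x"
  by (simp add: loops_def paths_between_def)

lemma path_homotopic_refl: "path_homotopic X a b p p \<longleftrightarrow> p \<in> paths_between X a b"
  by (simp add: paths_between_def pathin_def)

(* A reflexive homotopy shall be rewritten to membership, not to continuity and two equations. *)
declare homotopic_with_refl [simp del] path_homotopic_refl [simp]

lemma path_homotopic_imp_paths:
  assumes "path_homotopic X a b p q"
  shows "p \<in> paths_between X a b" "q \<in> paths_between X a b"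
  using homotopic_with_imp_continuous_maps[OF assms] homotopic_with_imp_property[OF assms]
  by (auto simp: paths_between_def pathin_def)

declare homotopic_with_trans [trans]

lemma path_homotopic_map:
  assumes "path_homotopic X a b p q" and "continuous_map X Z f"
  shows "path_homotopic Z (f a) (f b) (f \<circ> p) (f \<circ> q)"
  by (rule homotopic_with_compose_continuous_map_left[OF assms]) auto

lemma path_homotopic_subtopology:
  assumes "path_homotopic (subtopology X S) a b p q"
  shows "path_homotopic X a b p q"
  using path_homotopic_map[OF assms, of X id] by (simp add: continuous_map_from_subtopology)

text \<open>Straight lines join two paths in a convex set, so any map on that set makes them homotopic.
  Associativity, units and inverses for the joining of paths are the case of an interval; the
  commutativity of the fundamental group of a torus is the case of a square.\<close>

lemma path_homotopic_convex:
  fixes K :: "'v::real_normed_vector set"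
  assumes F: "continuous_map (top_of_set K) X F" and K: "convex K"
    and c: "continuous_on {0..1} c" "c \<in> {0..1} \<rightarrow> K"
    and d: "continuous_on {0..1} d" "d \<in> {0..1} \<rightarrow> K"
    and ends: "c 0 = d 0" "c 1 = d 1"
  shows "path_homotopic X (F (c 0)) (F (c 1)) (F \<circ> c) (F \<circ> d)"
proof -
  let ?h = "\<lambda>z::real \<times> real. (1 - fst z) *\<^sub>R c (snd z) + fst z *\<^sub>R d (snd z)"
  have "continuous_on ({0..1} \<times> {0..1}) ?h"
    by (intro continuous_intros continuous_on_compose2[OF c(1)] continuous_on_compose2[OF d(1)]) auto
  moreover have "?h ` ({0..1} \<times> {0..1}) \<subseteq> K"
    using c(2) d(2) K by (fastforce simp: convex_alt)
  ultimately have "continuous_map (prod_topology (top_of_set {0..1}) (top_of_set {0..1})) (top_of_set K) ?h"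
    by (auto simp flip: subtopology_Times simp: euclidean_product_topology)
  then have "path_homotopic (top_of_set K) (c 0) (c 1) c d"
    unfolding homotopic_with_def
    by (intro exI[of _ ?h]) (auto simp: ends algebra_simps simp flip: scaleR_add_left)
  then show ?thesis
    using F by (rule path_homotopic_map)
qed

lemma path_homotopic_reparametrize:
  assumes "pathin X p" and "continuous_on {0..1} c" "c \<in> {0..1} \<rightarrow> {0..1}"
    and "continuous_on {0..1} d" "d \<in> {0..1} \<rightarrow> {0..1}" and "c 0 = d 0" "c 1 = d 1"
  shows "path_homotopic X (p (c 0)) (p (c 1)) (p \<circ> c) (p \<circ> d)"
  using assms by (intro path_homotopic_convex) (auto simp: pathin_def)

lemma path_homotopic_join:
  assumes p: "path_homotopic X a b p p'" and q: "path_homotopic X b c q q'"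
  shows "path_homotopic X a c (loop_join p q) (loop_join p' q')"
proof -
  let ?I = "top_of_set {0..1::real}"
  let ?II = "prod_topology ?I ?I"
  obtain h where h: "continuous_map ?II X h" "\<And>t. h (0, t) = p t" "\<And>t. h (1, t) = p' t"
    "\<And>s. s \<in> {0..1} \<Longrightarrow> h (s, 0) = a \<and> h (s, 1) = b"
    using p unfolding homotopic_with_def by blast
  obtain k where k: "continuous_map ?II X k" "\<And>t. k (0, t) = q t" "\<And>t. k (1, t) = q' t"
    "\<And>s. s \<in> {0..1} \<Longrightarrow> k (s, 0) = b \<and> k (s, 1) = c"
    using q unfolding homotopic_with_def by blast
  have II: "?II = top_of_set ({0..1} \<times> {0..1})"
    by (auto simp flip: subtopology_Times simp: euclidean_product_topology)
  let ?H = "\<lambda>z::real \<times> real. if snd z \<le> 1/2 then h (fst z, 2 * snd z) else k (fst z, 2 * snd z - 1)"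
  have "continuous_map ?II X ?H"
  proof (rule continuous_map_cases_le)
    show "continuous_map ?II euclideanreal snd" "continuous_map ?II euclideanreal (\<lambda>z. 1/2)"
      unfolding II by (auto intro!: continuous_intros)
    have "continuous_map (subtopology ?II {z \<in> topspace ?II. snd z \<le> 1/2}) ?II (\<lambda>z. (fst z, 2 * snd z))"
      unfolding II by (auto simp: subtopology_subtopology intro!: continuous_intros)
    from continuous_map_compose[OF this h(1)]
    show "continuous_map (subtopology ?II {z \<in> topspace ?II. snd z \<le> 1/2}) X (\<lambda>z. h (fst z, 2 * snd z))"
      by (simp add: o_def)
    have "continuous_map (subtopology ?II {z \<in> topspace ?II. 1/2 \<le> snd z}) ?II (\<lambda>z. (fst z, 2 * snd z - 1))"
      unfolding II by (auto simp: subtopology_subtopology intro!: continuous_intros)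
    from continuous_map_compose[OF this k(1)]
    show "continuous_map (subtopology ?II {z \<in> topspace ?II. 1/2 \<le> snd z}) X (\<lambda>z. k (fst z, 2 * snd z - 1))"
      by (simp add: o_def)
    show "h (fst z, 2 * snd z) = k (fst z, 2 * snd z - 1)" if "z \<in> topspace ?II" "snd z = 1/2" for z
    proof -
      have "fst z \<in> {0..1}" "2 * snd z = 1"
        using that by auto
      then show ?thesis
        using h(4) k(4) by simp
    qed
  qed
  then show ?thesis
    unfolding homotopic_with_def
    by (intro exI[of _ ?H]) (auto simp: h(2-4) k(2-4) loop_join_def)
qed

lemma loop_join_paths:
  "\<lbrakk>p \<in> paths_between X a b; q \<in> paths_between X b c\<rbrakk> \<Longrightarrow> loop_join p q \<in> paths_between X a c"
  using path_homotopic_join[where p = p and p' = p and q = q and q' = q]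
  by (simp only: path_homotopic_refl)

lemma paths_between_topspace:
  assumes "p \<in> paths_between X a b"
  shows "a \<in> topspace X" "b \<in> topspace X"
  using assms by (force simp: paths_between_def pathin_def dest: continuous_map_image_subset_topspace)+

definition reverse_path :: "(real \<Rightarrow> 'a) \<Rightarrow> real \<Rightarrow> 'a" where
  "reverse_path p = (\<lambda>t. p (1 - t))"

lemma reverse_path_reverse [simp]: "reverse_path (reverse_path p) = p"
  by (simp add: reverse_path_def)

lemma reverse_path_paths:
  assumes "p \<in> paths_between X a b"
  shows "reverse_path p \<in> paths_between X b a"
proof -
  have "continuous_map (top_of_set {0..1::real}) (top_of_set {0..1}) (\<lambda>t. 1 - t)"
    by (auto intro!: continuous_intros)
  with assms have "continuous_map (top_of_set {0..1}) X (p \<circ> (\<lambda>t. 1 - t))"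
    unfolding paths_between_def pathin_def by (intro continuous_map_compose) auto
  with assms show ?thesis
    by (simp add: paths_between_def pathin_def reverse_path_def o_def)
qed

lemma continuous_on_if_le:
  fixes f g :: "real \<Rightarrow> real"
  assumes "continuous_on UNIV f" "continuous_on UNIV g" "f a = g a"
  shows "continuous_on S (\<lambda>t. if t \<le> a then f t else g t)"
proof -
  have "continuous_on UNIV (\<lambda>t. if t \<le> a then f t else g t)"
    using assms continuous_on_cases_le[of UNIV "\<lambda>t. t" a f g]
    by (auto intro: continuous_on_subset)
  then show ?thesis by (rule continuous_on_subset) simp
qed

text \<open>In this and the next three lemmas, both sides are reparametrizations of a single path, one of
  them by \<open>?c\<close>.\<close>

lemma path_homotopic_assoc:
  assumes "p \<in> paths_between X a b" "q \<in> paths_between X b c" "r \<in> paths_between X c d"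
  shows "path_homotopic X a d (loop_join (loop_join p q) r) (loop_join p (loop_join q r))"
proof -
  let ?F = "loop_join (loop_join p q) r"
  let ?c = "\<lambda>t::real. if t \<le> 1/2 then t/2 else if t \<le> 3/4 then t - 1/4 else 2*t - 1"
  have F: "?F \<in> paths_between X a d"
    using assms by (blast intro: loop_join_paths)
  have "continuous_on {0..1} ?c"
    by (intro continuous_on_if_le continuous_intros) auto
  then have "path_homotopic X (?F (id 0)) (?F (id 1)) (?F \<circ> id) (?F \<circ> ?c)"
    using F by (intro path_homotopic_reparametrize)
      (auto simp: paths_between_def id_def intro!: continuous_intros)
  moreover have "?F \<circ> ?c = loop_join p (loop_join q r)"
    by (auto simp: loop_join_def fun_eq_iff intro!: arg_cong[of _ _ p] arg_cong[of _ _ q] arg_cong[of _ _ r])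
  ultimately show ?thesis
    using F by (simp add: paths_between_def)
qed

lemma path_homotopic_left_unit:
  assumes p: "p \<in> paths_between X a b"
  shows "path_homotopic X a b (loop_join (\<lambda>_. a) p) p"
proof -
  let ?c = "\<lambda>t::real. if t \<le> 1/2 then 0 else 2*t - 1"
  have "continuous_on {0..1} ?c"
    by (intro continuous_on_if_le continuous_intros) auto
  then have "path_homotopic X (p (?c 0)) (p (?c 1)) (p \<circ> ?c) (p \<circ> id)"
    using p by (intro path_homotopic_reparametrize)
      (auto simp: paths_between_def id_def intro!: continuous_intros)
  moreover have "p \<circ> ?c = loop_join (\<lambda>_. a) p"
    using p by (auto simp: loop_join_def fun_eq_iff paths_between_def)
  ultimately show ?thesis
    using p by (simp add: paths_between_def)
qed

lemma path_homotopic_right_unit: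
  assumes p: "p \<in> paths_between X a b"
  shows "path_homotopic X a b (loop_join p (\<lambda>_. b)) p"
proof -
  let ?c = "\<lambda>t::real. if t \<le> 1/2 then 2*t else 1"
  have "continuous_on {0..1} ?c"
    by (intro continuous_on_if_le continuous_intros) auto
  then have "path_homotopic X (p (?c 0)) (p (?c 1)) (p \<circ> ?c) (p \<circ> id)"
    using p by (intro path_homotopic_reparametrize)
      (auto simp: paths_between_def id_def intro!: continuous_intros)
  moreover have "p \<circ> ?c = loop_join p (\<lambda>_. b)"
    using p by (auto simp: loop_join_def fun_eq_iff paths_between_def)
  ultimately show ?thesis
    using p by (simp add: paths_between_def)
qed

lemma path_homotopic_inverse:
  assumes p: "p \<in> paths_between X a b"
  shows "path_homotopic X a a (loop_join p (reverse_path p)) (\<lambda>_. a)"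
proof -
  let ?c = "\<lambda>t::real. if t \<le> 1/2 then 2*t else 2 - 2*t"
  have "continuous_on {0..1} ?c"
    by (intro continuous_on_if_le continuous_intros) auto
  then have "path_homotopic X (p (?c 0)) (p (?c 1)) (p \<circ> ?c) (p \<circ> (\<lambda>_. 0))"
    using p by (intro path_homotopic_reparametrize)
      (auto simp: paths_between_def intro!: continuous_intros)
  moreover have "p \<circ> ?c = loop_join p (reverse_path p)"
    by (auto simp: loop_join_def reverse_path_def fun_eq_iff)
  moreover have "p \<circ> (\<lambda>_. 0) = (\<lambda>_. a)"
    using p by (auto simp: paths_between_def)
  ultimately show ?thesis
    using p by (simp add: paths_between_def)
qed

lemma path_homotopic_cancel_left:
  assumes "p \<in> paths_between X a b" "q \<in> paths_between X a c"
  shows "path_homotopic X a c (loop_join p (loop_join (reverse_path p) q)) q"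
proof -
  have r: "reverse_path p \<in> paths_between X b a"
    using assms(1) by (rule reverse_path_paths)
  have "path_homotopic X a c (loop_join p (loop_join (reverse_path p) q))
      (loop_join (loop_join p (reverse_path p)) q)"
    using path_homotopic_assoc[OF assms(1) r assms(2)] by (rule homotopic_with_symD)
  also have "path_homotopic X a c \<dots> (loop_join (\<lambda>_. a) q)"
    using path_homotopic_inverse[OF assms(1)] assms(2)
    by (blast intro: path_homotopic_join path_homotopic_refl[THEN iffD2])
  also have "path_homotopic X a c \<dots> q"
    using assms(2) by (rule path_homotopic_left_unit)
  finally show ?thesis .
qed

section \<open>Commuting matrices in \<open>SU(2)\<close>\<close>

lemma SU2_mult [simp]: "A \<otimes>\<^bsub>SU2\<^esub> B = A ** B"
  by (simp add: SU2_def)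

lemma conj_transpose_mult:
  fixes A :: "complex^'n^'m" and B :: "complex^'k^'n"
  shows "conj_transpose (A ** B) = conj_transpose B ** conj_transpose A"
  by (simp add: conj_transpose_def matrix_matrix_mult_def vec_eq_iff cnj_sum mult.commute)

lemma conj_transpose_twice [simp]: "conj_transpose (conj_transpose A) = A"
  by (simp add: conj_transpose_def vec_eq_iff)

lemma SU2_inverse:
  assumes "A \<in> carrier SU2"
  shows "A ** conj_transpose A = mat 1" "conj_transpose A ** A = mat 1"
  using assms matrix_left_right_inverse[of A "conj_transpose A"] by (auto simp: SU2_def)

lemma SU2_mult_closed: 
  assumes "A \<in> carrier SU2" "B \<in> carrier SU2"
  shows "A ** B \<in> carrier SU2"
proof -
  have "A ** B ** conj_transpose (A ** B) = A ** (B ** conj_transpose B) ** conj_transpose A"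
    by (simp add: conj_transpose_mult matrix_mul_assoc)
  with assms show ?thesis
    by (simp add: SU2_def det_mul)
qed

lemma SU2_conj_transpose_closed:
  assumes "A \<in> carrier SU2"
  shows "conj_transpose A \<in> carrier SU2"
proof -
  have "det (conj_transpose A) = cnj (det A)"
    by (simp add: conj_transpose_def det_2)
  with assms have "det (conj_transpose A) = 1"
    by (simp add: SU2_def)
  with SU2_inverse(2)[OF assms] show ?thesis
    by (simp add: SU2_def)
qed

lemma one_in_SU2: "mat 1 \<in> carrier SU2"
proof -
  have "conj_transpose (mat 1) = (mat 1 :: complex^2^2)"
    by (auto simp: conj_transpose_def mat_def vec_eq_iff)
  then show ?thesis
    by (simp add: SU2_def)
qed

lemma SU2_conj_mult:
  assumes "P \<in> carrier SU2"
  shows "(conj_transpose P ** A ** P) ** (conj_transpose P ** B ** P) = conj_transpose P ** (A ** B) ** P"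
proof -
  have "(conj_transpose P ** A ** P) ** (conj_transpose P ** B ** P)
      = conj_transpose P ** A ** (P ** conj_transpose P) ** B ** P"
    by (simp only: matrix_mul_assoc)
  then show ?thesis
    by (simp add: SU2_inverse(1)[OF assms] matrix_mul_assoc)
qed

abbreviation diagonal :: "complex^2^2 \<Rightarrow> bool" where
  "diagonal A \<equiv> A $ 1 $ 2 = 0 \<and> A $ 2 $ 1 = 0"

lemma U1_eq: "carrier U1 = {A \<in> carrier SU2. diagonal A}"
  by (auto simp: U1_def forall_2)

text \<open>The rows are orthogonal, and the second one is a nonzero multiple of \<open>(0, 1)\<close>.\<close>

lemma SU2_upper_triangular_diagonal:
  assumes "A \<in> carrier SU2" "A $ 2 $ 1 = 0"
  shows "A $ 1 $ 2 = 0"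
proof -
  have "A $ 1 $ 1 * A $ 2 $ 2 = 1"
    using assms by (simp add: SU2_def det_2)
  moreover have "(A ** conj_transpose A) $ 1 $ 2 = 0"
    using SU2_inverse(1)[OF assms(1)] by (simp add: mat_def)
  then have "A $ 1 $ 2 * cnj (A $ 2 $ 2) = 0"
    using assms(2) by (simp add: matrix_matrix_mult_def sum_2 conj_transpose_def)
  ultimately show ?thesis
    by auto
qed

lemma complex_quadratic_root:
  obtains z :: complex where "z^2 - t * z + d = 0"
proof
  let ?s = "csqrt (t^2 - 4*d)"
  have "((t + ?s) / 2)^2 - t * ((t + ?s) / 2) + d = (?s^2 - (t^2 - 4*d)) / 4"
    by (simp add: field_simps power2_eq_square)
  then show "((t + ?s) / 2)^2 - t * ((t + ?s) / 2) + d = 0"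
    by (simp only: power2_csqrt) simp
qed

lemma eigenvector_exists:
  fixes A :: "complex^2^2"
  obtains l u w where "(u, w) \<noteq> (0, 0)"
    "A $ 1 $ 1 * u + A $ 1 $ 2 * w = l * u" "A $ 2 $ 1 * u + A $ 2 $ 2 * w = l * w"
proof -
  obtain l where "l^2 - (A $ 1 $ 1 + A $ 2 $ 2) * l + (A $ 1 $ 1 * A $ 2 $ 2 - A $ 1 $ 2 * A $ 2 $ 1) = 0"
    by (rule complex_quadratic_root)
  then have l: "(l - A $ 1 $ 1) * (l - A $ 2 $ 2) = A $ 1 $ 2 * A $ 2 $ 1"
    by (simp add: algebra_simps power2_eq_square)
  show ?thesis
    \<comment> \<open>If \<open>A $ 1 $ 2 \<noteq> 0\<close>, the first row alone determines the eigenvector for \<open>l\<close> up to a factor.\<close>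
  proof (cases "A $ 1 $ 2 = 0")
    case False
    then show ?thesis
      using l by (intro that[of "A $ 1 $ 2" "l - A $ 1 $ 1" l]) (auto simp: algebra_simps)
  next
    case True
    then show ?thesis
      by (intro that[of 0 1 "A $ 2 $ 2"]) auto
  qed
qed

text \<open>The spectral theorem for \<open>SU(2)\<close>: a unit eigenvector \<open>(u, w)\<close> is the first column of the
  special unitary matrix with second column \<open>(-cnj w, cnj u)\<close>, which conjugates \<open>A\<close> to a triangular,
  hence diagonal matrix.\<close>

lemma SU2_diagonalizable:
  assumes A: "A \<in> carrier SU2"
  obtains P where "P \<in> carrier SU2" "diagonal (conj_transpose P ** A ** P)"
proof -
  obtain l u0 w0 where nz: "(u0, w0) \<noteq> (0, 0)"
    and ev: "A $ 1 $ 1 * u0 + A $ 1 $ 2 * w0 = l * u0" "A $ 2 $ 1 * u0 + A $ 2 $ 2 * w0 = l * w0"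
    by (rule eigenvector_exists)
  define n where "n = complex_of_real (norm (u0, w0))"
  have n: "n \<noteq> 0" using nz by (simp add: n_def zero_prod_def)
  have n2: "n * n = u0 * cnj u0 + w0 * cnj w0"
  proof -
    have "n * n = complex_of_real ((norm (u0, w0))\<^sup>2)"
      by (simp add: n_def power2_eq_square)
    also have "\<dots> = complex_of_real ((norm u0)\<^sup>2) + complex_of_real ((norm w0)\<^sup>2)"
      by (simp add: norm_prod_def)
    finally show ?thesis
      by (simp only: complex_norm_square)
  qed
  define u w where "u = u0 / n" and "w = w0 / n"
  have cn: "cnj n = n" by (simp add: n_def)
  have unit: "u * cnj u + w * cnj w = 1"
  proof -
    have "u * cnj u + w * cnj w = (u0 * cnj u0 + w0 * cnj w0) / (n * n)"
      by (simp add: u_def w_def cn add_divide_distrib)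
    then show ?thesis
      using n by (simp flip: n2)
  qed
  have ev': "A $ 1 $ 1 * u + A $ 1 $ 2 * w = l * u" "A $ 2 $ 1 * u + A $ 2 $ 2 * w = l * w"
    using ev by (simp_all add: u_def w_def flip: add_divide_distrib)
  define P :: "complex^2^2" where "P = vector [vector [u, - cnj w], vector [w, cnj u]]"
  have P: "P \<in> carrier SU2"
    using unit
    by (simp add: SU2_def P_def conj_transpose_def matrix_matrix_mult_def sum_2 mat_def vec_eq_iff
        forall_2 det_2 algebra_simps)
  let ?D = "conj_transpose P ** A ** P"
  have D: "?D \<in> carrier SU2"
    using A P by (simp add: SU2_mult_closed SU2_conj_transpose_closed)
  have "?D $ 2 $ 1 = - w * (A $ 1 $ 1 * u + A $ 1 $ 2 * w) + u * (A $ 2 $ 1 * u + A $ 2 $ 2 * w)"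
    by (simp add: P_def conj_transpose_def matrix_matrix_mult_def sum_2 algebra_simps)
  also have "\<dots> = 0"
    by (simp add: ev')
  finally have "?D $ 2 $ 1 = 0" .
  with SU2_upper_triangular_diagonal[OF D] P that show ?thesis
    by blast
qed

text \<open>If some matrix of the family is not diagonal, then it is not scalar, and after diagonalizing
  it has distinct diagonal entries; a matrix that commutes with it must then be diagonal too.\<close>

lemma commuting_SU2_simultaneously_diagonalizable:
  assumes S: "S \<subseteq> carrier SU2" and comm: "\<And>A B. A \<in> S \<Longrightarrow> B \<in> S \<Longrightarrow> A ** B = B ** A"
  obtains P where "P \<in> carrier SU2" "\<And>A. A \<in> S \<Longrightarrow> conj_transpose P ** A ** P \<in> carrier U1"
proof (cases "\<forall>A\<in>S. diagonal A")
  case True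
  have "conj_transpose (mat 1) = (mat 1 :: complex^2^2)"
    by (auto simp: conj_transpose_def mat_def vec_eq_iff)
  with True S that[of "mat 1"] one_in_SU2 show ?thesis
    by (auto simp: U1_eq)
next
  case False
  then obtain A where A: "A \<in> S" "\<not> diagonal A"
    by blast
  then obtain P where P: "P \<in> carrier SU2" "diagonal (conj_transpose P ** A ** P)"
    using S SU2_diagonalizable by blast
  let ?c = "\<lambda>B. conj_transpose P ** B ** P"
  have inv: "P ** conj_transpose P = mat 1" "conj_transpose P ** P = mat 1"
    using SU2_inverse[OF P(1)] .
  have distinct: "?c A $ 1 $ 1 \<noteq> ?c A $ 2 $ 2"
  proof
    assume "?c A $ 1 $ 1 = ?c A $ 2 $ 2"
    with P(2) have eq: "?c A = mat (?c A $ 1 $ 1)"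
      by (simp add: vec_eq_iff forall_2 mat_def)
    have "A = (P ** conj_transpose P) ** A ** (P ** conj_transpose P)"
      by (simp add: inv)
    also have "\<dots> = P ** ?c A ** conj_transpose P"
      by (simp only: matrix_mul_assoc)
    also have "\<dots> = P ** mat (?c A $ 1 $ 1) ** conj_transpose P"
      using eq by simp
    also have "P ** mat (?c A $ 1 $ 1) = mat (?c A $ 1 $ 1) ** P"
      by (simp add: vec_eq_iff forall_2 mat_def matrix_matrix_mult_def sum_2)
    finally have "A = mat (?c A $ 1 $ 1)"
      by (simp add: inv flip: matrix_mul_assoc)
    moreover have "diagonal (mat (?c A $ 1 $ 1))"
      by (simp add: mat_def)
    ultimately show False
      using A(2) by metis
  qed
  have "diagonal (?c B)" if B: "B \<in> S" for B
  proof -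
    have "?c A ** ?c B = ?c B ** ?c A"
      using comm[OF A(1) B] by (simp add: SU2_conj_mult[OF P(1)])
    then have "(?c A ** ?c B) $ i $ j = (?c B ** ?c A) $ i $ j" for i j
      by simp
    from this[of 1 2] this[of 2 1] show ?thesis
      using P(2) distinct by (simp add: matrix_matrix_mult_def[of "?c A"] matrix_matrix_mult_def[of _ "?c A"] sum_2)
  qed
  then show ?thesis
    using S P(1) by (intro that[of P]) (auto simp: U1_eq SU2_mult_closed SU2_conj_transpose_closed)
qed

section \<open>Homomorphisms between fundamental groups\<close>

lemma loop_class_eq: "loop_class X x p = {q. path_homotopic X x x p q}"
  by (simp add: loop_class_def)

lemma loop_class_eqI:
  assumes "path_homotopic X x x p q"
  shows "loop_class X x p = loop_class X x q"
  unfolding loop_class_eq using assms homotopic_with_trans homotopic_with_symD by blast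

text \<open>The products and induced maps on \<^const>\<open>pi1\<close> are unions over representatives; a union over a
  homotopy class of values that do not depend on the representative is just this common value.\<close>

lemma UN_loop_class:
  assumes p: "p \<in> loops X x"
    and f: "\<And>q. path_homotopic X x x p q \<Longrightarrow> f q = f p"
  shows "(\<Union>q\<in>loop_class X x p. f q) = f p"
proof -
  have "p \<in> loop_class X x p"
    using p by (simp add: loop_class_eq path_homotopic_refl loops_eq_paths_between)
  then show ?thesis
    using f unfolding loop_class_eq by blast
qed

lemma carrier_pi1: "carrier (pi1 X x) = loop_class X x ` loops X x"
  by (simp add: pi1_def)

lemma pi1_mult_classes:
  assumes "p \<in> loops X x" "q \<in> loops X x"
  shows "loop_class X x p \<otimes>\<^bsub>pi1 X x\<^esub> loop_class X x q = loop_class X x (loop_join p q)"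
proof -
  have "(\<Union>q'\<in>loop_class X x q. loop_class X x (loop_join p' q')) = loop_class X x (loop_join p' q)"
    if "p' \<in> loops X x" for p'
    using that assms(2) unfolding loops_eq_paths_between path_homotopic_refl[symmetric]
    by (intro UN_loop_class loop_class_eqI[symmetric] path_homotopic_join)
      (simp_all add: loops_eq_paths_between path_homotopic_refl)
  moreover have "p' \<in> loops X x" if "p' \<in> loop_class X x p" for p'
    using that path_homotopic_imp_paths(2) by (simp add: loop_class_eq loops_eq_paths_between)
  ultimately have "loop_class X x p \<otimes>\<^bsub>pi1 X x\<^esub> loop_class X x q
      = (\<Union>p'\<in>loop_class X x p. loop_class X x (loop_join p' q))"
    by (simp add: pi1_def)
  also have "\<dots> = loop_class X x (loop_join p q)"
    using assms unfolding loops_eq_paths_between path_homotopic_refl[symmetric]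
    by (intro UN_loop_class loop_class_eqI[symmetric] path_homotopic_join)
      (simp_all add: loops_eq_paths_between path_homotopic_refl)
  finally show ?thesis .
qed

text \<open>A map \<open>\<Gamma>\<close> on loops that respects homotopy and, up to homotopy, joining acts on the
  fundamental groups; a change of the base point and the inclusion of a subspace are both of
  this kind.\<close>

definition pi1_lift :: "'b topology \<Rightarrow> 'b \<Rightarrow> ((real \<Rightarrow> 'a) \<Rightarrow> real \<Rightarrow> 'b) \<Rightarrow> (real \<Rightarrow> 'a) set \<Rightarrow> (real \<Rightarrow> 'b) set" where
  "pi1_lift Z z \<Gamma> a = (\<Union>p\<in>a. loop_class Z z (\<Gamma> p))"

lemma pi1_lift_class:
  assumes "\<And>p q. path_homotopic X x x p q \<Longrightarrow> path_homotopic Z z z (\<Gamma> p) (\<Gamma> q)"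
    and "p \<in> loops X x"
  shows "pi1_lift Z z \<Gamma> (loop_class X x p) = loop_class Z z (\<Gamma> p)"
  unfolding pi1_lift_def using assms
  by (intro UN_loop_class loop_class_eqI[symmetric]) auto

lemma pi1_lift_hom:
  assumes hom: "\<And>p q. path_homotopic X x x p q \<Longrightarrow> path_homotopic Z z z (\<Gamma> p) (\<Gamma> q)"
    and join: "\<And>p q. \<lbrakk>p \<in> loops X x; q \<in> loops X x\<rbrakk> \<Longrightarrow>
      path_homotopic Z z z (\<Gamma> (loop_join p q)) (loop_join (\<Gamma> p) (\<Gamma> q))"
  shows "pi1_lift Z z \<Gamma> \<in> hom (pi1 X x) (pi1 Z z)"
proof -
  have \<Gamma>: "\<Gamma> p \<in> loops Z z" if "p \<in> loops X x" for p
    using hom[of p p] that by (simp add: path_homotopic_refl loops_eq_paths_between)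
  have join_loop: "loop_join p q \<in> loops X x" if "p \<in> loops X x" "q \<in> loops X x" for p q
    using that by (auto simp: loops_eq_paths_between intro: loop_join_paths)
  show ?thesis
    by (rule homI)
      (auto simp: carrier_pi1 pi1_mult_classes pi1_lift_class[OF hom] \<Gamma> join_loop
        loop_class_eqI[OF join])
qed

lemma pi1_incl_eq_lift: "pi1_incl X x = pi1_lift X x (\<lambda>p. p)"
  by (simp add: pi1_incl_def pi1_lift_def fun_eq_iff)

lemma loops_subtopology: "p \<in> loops (subtopology X S) x \<Longrightarrow> p \<in> loops X x"
  using path_homotopic_subtopology[where p = p and q = p]
  by (simp only: path_homotopic_refl loops_eq_paths_between)

lemma pi1_incl_class:
  "p \<in> loops (subtopology X S) x \<Longrightarrow> pi1_incl X x (loop_class (subtopology X S) x p) = loop_class X x p"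
  unfolding pi1_incl_eq_lift by (rule pi1_lift_class[OF path_homotopic_subtopology])

lemma pi1_incl_hom: "pi1_incl X x \<in> hom (pi1 (subtopology X S) x) (pi1 X x)"
  unfolding pi1_incl_eq_lift
proof (rule pi1_lift_hom[OF path_homotopic_subtopology])
  fix p q assume "p \<in> loops (subtopology X S) x" "q \<in> loops (subtopology X S) x"
  then have "loop_join p q \<in> loops X x"
    by (metis loops_subtopology loops_eq_paths_between loop_join_paths)
  then show "path_homotopic X x x (loop_join p q) (loop_join p q)"
    by (simp only: path_homotopic_refl loops_eq_paths_between)
qed

text \<open>Conjugation with a path from \<open>y\<close> to \<open>x\<close> is onto, because a loop \<open>r\<close> at \<open>y\<close> is homotopic to the
  conjugate of its own conjugate with the reversed path.\<close>

lemma change_of_base_point: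
  assumes g: "g \<in> paths_between X y x"
  obtains f where "f \<in> hom (pi1 X x) (pi1 X y)" "f ` carrier (pi1 X x) = carrier (pi1 X y)"
proof -
  define \<Gamma> where "\<Gamma> p = loop_join g (loop_join p (reverse_path g))" for p
  have g': "reverse_path g \<in> paths_between X x y"
    using g by (rule reverse_path_paths)
  note refl = path_homotopic_refl[THEN iffD2]
  have \<Gamma>_hom: "path_homotopic X y y (\<Gamma> p) (\<Gamma> q)" if "path_homotopic X x x p q" for p q
    using that g g' unfolding \<Gamma>_def by (intro path_homotopic_join refl)
  have \<Gamma>_join: "path_homotopic X y y (\<Gamma> (loop_join p q)) (loop_join (\<Gamma> p) (\<Gamma> q))"
    if p: "p \<in> loops X x" and q: "q \<in> loops X x" for p q
  proof -
    let ?g' = "reverse_path g"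
    have pq: "p \<in> paths_between X x x" "q \<in> paths_between X x x"
      using p q by (simp_all add: loops_eq_paths_between)
    have q': "loop_join q ?g' \<in> paths_between X x y"
      using pq(2) g' by (rule loop_join_paths)
    have p': "loop_join p ?g' \<in> paths_between X x y"
      using pq(1) g' by (rule loop_join_paths)
    have \<Gamma>q: "\<Gamma> q \<in> paths_between X y y"
      unfolding \<Gamma>_def using g q' by (rule loop_join_paths)
    have "path_homotopic X x y (loop_join q ?g') (loop_join ?g' (\<Gamma> q))"
      unfolding \<Gamma>_def using path_homotopic_cancel_left[OF g' q']
      by (simp add: homotopic_with_symD)
    then have "path_homotopic X x y (loop_join p (loop_join q ?g')) (loop_join p (loop_join ?g' (\<Gamma> q)))"
      by (rule path_homotopic_join[OF refl[OF pq(1)]])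
    moreover have "path_homotopic X x y (loop_join (loop_join p q) ?g') (loop_join p (loop_join q ?g'))"
      using pq g' by (rule path_homotopic_assoc)
    moreover have "path_homotopic X x y (loop_join p (loop_join ?g' (\<Gamma> q))) (loop_join (loop_join p ?g') (\<Gamma> q))"
      by (rule homotopic_with_symD) (rule path_homotopic_assoc[OF pq(1) g' \<Gamma>q])
    ultimately have "path_homotopic X x y (loop_join (loop_join p q) ?g') (loop_join (loop_join p ?g') (\<Gamma> q))"
      by (meson homotopic_with_trans)
    then have "path_homotopic X y y (\<Gamma> (loop_join p q)) (loop_join g (loop_join (loop_join p ?g') (\<Gamma> q)))"
      unfolding \<Gamma>_def[of "loop_join p q"] by (rule path_homotopic_join[OF refl[OF g]])
    also have "path_homotopic X y y \<dots> (loop_join (\<Gamma> p) (\<Gamma> q))"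
      unfolding \<Gamma>_def[of p] by (rule homotopic_with_symD) (rule path_homotopic_assoc[OF g p' \<Gamma>q])
    finally show ?thesis .
  qed
  let ?f = "pi1_lift X y \<Gamma>"
  have hom: "?f \<in> hom (pi1 X x) (pi1 X y)"
    by (rule pi1_lift_hom[OF \<Gamma>_hom \<Gamma>_join])
  moreover have "carrier (pi1 X y) \<subseteq> ?f ` carrier (pi1 X x)"
  proof
    fix c assume "c \<in> carrier (pi1 X y)"
    then obtain r where r: "r \<in> paths_between X y y" "c = loop_class X y r"
      by (auto simp: carrier_pi1 loops_eq_paths_between)
    let ?g' = "reverse_path g"
    have rg: "loop_join r g \<in> paths_between X y x"
      using r(1) g by (rule loop_join_paths)
    have p: "loop_join ?g' (loop_join r g) \<in> loops X x"
      unfolding loops_eq_paths_between using g' rg by (rule loop_join_paths)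
    have rgg: "loop_join (loop_join r g) ?g' \<in> paths_between X y y"
      using rg g' by (rule loop_join_paths)
    have "path_homotopic X y y (\<Gamma> (loop_join ?g' (loop_join r g)))
        (loop_join g (loop_join ?g' (loop_join (loop_join r g) ?g')))"
      unfolding \<Gamma>_def by (rule path_homotopic_join[OF refl[OF g] path_homotopic_assoc[OF g' rg g']])
    also have "path_homotopic X y y \<dots> (loop_join (loop_join r g) ?g')"
      using g rgg by (rule path_homotopic_cancel_left)
    also have "path_homotopic X y y \<dots> (loop_join r (loop_join g ?g'))"
      using r(1) g g' by (rule path_homotopic_assoc)
    also have "path_homotopic X y y \<dots> (loop_join r (\<lambda>_. y))"
      using r(1) path_homotopic_inverse[OF g] by (intro path_homotopic_join refl)
    also have "path_homotopic X y y \<dots> r"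
      using r(1) by (rule path_homotopic_right_unit)
    finally have "c = ?f (loop_class X x (loop_join ?g' (loop_join r g)))"
      using r(2) p by (simp add: pi1_lift_class[OF \<Gamma>_hom] loop_class_eqI)
    then show "c \<in> ?f ` carrier (pi1 X x)"
      using p by (auto simp: carrier_pi1)
  qed
  moreover have "?f ` carrier (pi1 X x) \<subseteq> carrier (pi1 X y)"
    using hom by (auto simp: hom_def)
  ultimately show ?thesis
    using that by blast
qed

section \<open>The fundamental group of a torus\<close>

text \<open>Multiplication and division in the group \<open>S\<^sup>1 \<times> S\<^sup>1\<close> turn two loops \<open>p\<close>, \<open>q\<close> at \<open>e\<close> into the map
  \<open>(s, t) \<mapsto> p s * q t / e\<close> on the square. Its values on one way along the boundary of the square from
  \<open>(0, 0)\<close> to \<open>(1, 1)\<close> are \<open>p\<close> followed by \<open>q\<close>, and on the other way \<open>q\<close> followed by \<open>p\<close>.\<close>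

lemma torus_loops_commute:
  assumes p: "p \<in> loops torus e" and q: "q \<in> loops torus e"
  shows "path_homotopic torus e e (loop_join p q) (loop_join q p)"
proof -
  have torus: "torus = top_of_set (sphere 0 1 \<times> sphere 0 1)"
    unfolding torus_def by (auto simp flip: subtopology_Times simp: euclidean_product_topology)
  have pc: "continuous_on {0..1} p" "p \<in> {0..1} \<rightarrow> sphere 0 1 \<times> sphere 0 1" "p 0 = e" "p 1 = e"
    using p by (auto simp: loops_def pathin_def torus)
  have qc: "continuous_on {0..1} q" "q \<in> {0..1} \<rightarrow> sphere 0 1 \<times> sphere 0 1" "q 0 = e" "q 1 = e"
    using q by (auto simp: loops_def pathin_def torus)
  have e: "norm (fst e) = 1" "norm (snd e) = 1"
    using pc(2,3) by (force simp: mem_Times_iff)+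
  have nz: "fst e \<noteq> 0" "snd e \<noteq> 0"
    using e by auto
  let ?Q = "{0..1::real} \<times> {0..1::real}"
  define F where "F z = (fst (p (fst z)) * fst (q (snd z)) / fst e, snd (p (fst z)) * snd (q (snd z)) / snd e)"
    for z :: "real \<times> real"
  have "continuous_on ?Q F"
    unfolding F_def using nz
    by (intro continuous_intros continuous_on_compose2[OF pc(1)] continuous_on_compose2[OF qc(1)]) auto
  moreover have "F \<in> ?Q \<rightarrow> sphere 0 1 \<times> sphere 0 1"
    using pc(2) qc(2) e by (force simp: F_def mem_Times_iff norm_mult norm_divide Pi_iff)
  ultimately have F: "continuous_map (top_of_set ?Q) torus F"
    by (simp add: torus)
  let ?c = "\<lambda>t::real. (if t \<le> 1/2 then 2*t else 1, if t \<le> 1/2 then 0 else 2*t - 1)"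
  let ?d = "\<lambda>t::real. (if t \<le> 1/2 then 0 else 2*t - 1, if t \<le> 1/2 then 2*t else 1)"
  have "continuous_on {0..1} ?c" "continuous_on {0..1} ?d"
    by (intro continuous_on_Pair continuous_on_if_le continuous_intros; simp)+
  then have "path_homotopic torus (F (?c 0)) (F (?c 1)) (F \<circ> ?c) (F \<circ> ?d)"
    by (intro path_homotopic_convex[OF F]) (auto intro!: convex_Times)
  moreover have "F \<circ> ?c = loop_join p q" "F \<circ> ?d = loop_join q p"
    using nz pc(3,4) qc(3,4) by (auto simp: F_def loop_join_def fun_eq_iff)
  moreover have "F (?c 0) = e" "F (?c 1) = e"
    using nz pc(3,4) qc(3,4) by (simp_all add: F_def)
  ultimately show ?thesis
    by simp
qed

lemma loops_commute_of_homeomorphic_torus: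
  assumes X: "X homeomorphic_space torus" and p: "p \<in> loops X x" and q: "q \<in> loops X x"
  shows "path_homotopic X x x (loop_join p q) (loop_join q p)"
proof -
  obtain h k where h: "continuous_map X torus h" and k: "continuous_map torus X k"
    and kh: "\<And>y. y \<in> topspace X \<Longrightarrow> k (h y) = y"
    using X by (auto simp: homeomorphic_space_def homeomorphic_maps_def)
  have x: "x \<in> topspace X"
    using p by (auto simp: loops_eq_paths_between dest: paths_between_topspace)
  have "h \<circ> r \<in> loops torus (h x)" if "r \<in> loops X x" for r
    using path_homotopic_map[where p = r and q = r and f = h] that h
    by (simp only: path_homotopic_refl loops_eq_paths_between)
  then have "path_homotopic torus (h x) (h x) (loop_join (h \<circ> p) (h \<circ> q)) (loop_join (h \<circ> q) (h \<circ> p))"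
    using p q by (intro torus_loops_commute)
  from path_homotopic_map[OF this k]
  have "path_homotopic X x x (k \<circ> loop_join (h \<circ> p) (h \<circ> q)) (k \<circ> loop_join (h \<circ> q) (h \<circ> p))"
    using x kh by simp
  \<comment> \<open>Loops are arbitrary outside the unit interval, and there \<open>k \<circ> h\<close> may change them.\<close>
  moreover have "path_homotopic X x x (loop_join r s) (k \<circ> loop_join (h \<circ> r) (h \<circ> s))"
    if "r \<in> loops X x" "s \<in> loops X x" for r s
  proof -
    have rs: "loop_join r s \<in> paths_between X x x"
      using that by (auto simp: loops_eq_paths_between intro: loop_join_paths)
    then have "k (h (loop_join r s t)) = loop_join r s t" if "t \<in> {0..1}" for t
      using that by (intro kh) (force simp: paths_between_def pathin_def dest: continuous_map_image_subset_topspace)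
    moreover have "k \<circ> loop_join (h \<circ> r) (h \<circ> s) = (\<lambda>t. k (h (loop_join r s t)))"
      by (auto simp: loop_join_def)
    ultimately show ?thesis
      using rs by (intro homotopic_with_equal) (auto simp: paths_between_def pathin_def)
  qed
  ultimately show ?thesis
    using p q by (meson homotopic_with_trans homotopic_with_symD)
qed

section \<open>Representations of a space with a torus in it\<close>

text \<open>A representation of the whole space restricts to \<open>Z\<close>, so it witnesses its own restriction to
  \<open>S\<close> as extendible over \<open>Z\<close>; only diagonality on \<open>S\<close> is a condition.\<close>

lemma T_set_restriction:
  assumes \<rho>: "\<rho> \<in> hom (pi1 Y x) SU2" and S: "S \<subseteq> Z"
    and U1: "\<And>a. a \<in> carrier (pi1 (subtopology Y S) x) \<Longrightarrow> \<rho> (pi1_incl Y x a) \<in> carrier U1"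
  shows "\<rho> \<circ> pi1_incl Y x \<in> T_set (subtopology Y Z) S x"
proof -
  have sub: "subtopology (subtopology Y Z) S = subtopology Y S"
    using S by (simp add: subtopology_subtopology Int_absorb1)
  have "\<rho> \<circ> pi1_incl Y x \<in> hom (pi1 (subtopology Y S) x) SU2"
    and Z: "\<rho> \<circ> pi1_incl Y x \<in> hom (pi1 (subtopology Y Z) x) SU2"
    by (rule hom_compose[OF pi1_incl_hom \<rho>])+
  then have "\<rho> \<circ> pi1_incl Y x \<in> hom (pi1 (subtopology Y S) x) U1"
    using U1 by (auto simp: hom_def U1_def)
  moreover have "pi1_incl Y x (pi1_incl (subtopology Y Z) x a) = pi1_incl Y x a"
    if a: "a \<in> carrier (pi1 (subtopology Y S) x)" for a
  proof -
    obtain p where p: "p \<in> loops (subtopology Y S) x" "a = loop_class (subtopology Y S) x p"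
      using a by (auto simp: carrier_pi1)
    have "pi1_incl (subtopology Y Z) x a = loop_class (subtopology Y Z) x p"
      using pi1_incl_class[of p "subtopology Y Z" S x] p by (simp add: sub)
    moreover have "p \<in> loops (subtopology Y Z) x"
      using loops_subtopology[of p "subtopology Y Z" S x] p by (simp add: sub)
    ultimately show ?thesis
      using p by (simp add: pi1_incl_class)
  qed
  ultimately show ?thesis
    unfolding T_set_def sub by (auto intro!: bexI[OF _ Z])
qed

lemma conj_hom_SU2:
  assumes \<rho>: "\<rho> \<in> hom G SU2" and P: "P \<in> carrier SU2"
  shows "(\<lambda>a. conj_transpose P ** \<rho> a ** P) \<in> hom G SU2"
proof (rule homI)
  fix a b assume ab: "a \<in> carrier G" "b \<in> carrier G"
  then show "conj_transpose P ** \<rho> a ** P \<in> carrier SU2"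
    using P by (intro SU2_mult_closed SU2_conj_transpose_closed hom_in_carrier[OF \<rho>])
  show "conj_transpose P ** \<rho> (a \<otimes>\<^bsub>G\<^esub> b) ** P
      = (conj_transpose P ** \<rho> a ** P) \<otimes>\<^bsub>SU2\<^esub> (conj_transpose P ** \<rho> b ** P)"
    using hom_mult[OF \<rho> ab] by (simp add: SU2_conj_mult[OF P])
qed

lemma abelian_image_conj:
  assumes P: "P \<in> carrier SU2" and "abelian_image G (\<lambda>a. conj_transpose P ** \<rho> a ** P)"
  shows "abelian_image G \<rho>"
proof -
  have undo: "P ** (conj_transpose P ** M ** P) ** conj_transpose P = M" for M
  proof -
    have "P ** (conj_transpose P ** M ** P) ** conj_transpose P
        = (P ** conj_transpose P) ** M ** (P ** conj_transpose P)"
      by (simp only: matrix_mul_assoc)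
    then show ?thesis
      by (simp add: SU2_inverse(1)[OF P])
  qed
  have "\<rho> a ** \<rho> b = \<rho> b ** \<rho> a" if "a \<in> carrier G" "b \<in> carrier G" for a b
  proof -
    have "conj_transpose P ** (\<rho> a ** \<rho> b) ** P = conj_transpose P ** (\<rho> b ** \<rho> a) ** P"
      using assms(2) that by (simp add: abelian_image_def flip: SU2_conj_mult[OF P])
    then show ?thesis
      by (metis undo)
  qed
  then show ?thesis
    by (auto simp: abelian_image_def)
qed

text \<open>Moving the base point to the torus precomposes \<open>\<rho>\<close> with a map that is onto, so it does not
  change the image of \<open>\<rho>\<close>; the conjugation that makes the restriction to the torus diagonal does not
  change whether the image is abelian.\<close>

lemma SU2_abelian_of_torus_reps_abelian:
  assumes Y: "path_connected_space Y" and torus: "subtopology Y S homeomorphic_space torus"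
    and x: "x \<in> S" "x \<in> topspace Y" and S: "S \<subseteq> Z1" "S \<subseteq> Z2"
    and reps: "\<And>\<rho>. \<lbrakk>\<rho> \<in> hom (pi1 Y x) SU2;
      \<rho> \<circ> pi1_incl Y x \<in> T_set (subtopology Y Z1) S x \<inter> T_set (subtopology Y Z2) S x\<rbrakk>
      \<Longrightarrow> abelian_image (pi1 Y x) \<rho>"
  shows "SU2_abelian Y"
  unfolding SU2_abelian_def
proof (intro ballI)
  fix y \<rho> assume y: "y \<in> topspace Y" and \<rho>: "\<rho> \<in> hom (pi1 Y y) SU2"
  obtain g where "g \<in> paths_between Y y x"
    using Y y x(2) by (auto simp: path_connected_space_def paths_between_def)
  then obtain f where f: "f \<in> hom (pi1 Y x) (pi1 Y y)" "f ` carrier (pi1 Y x) = carrier (pi1 Y y)"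
    by (rule change_of_base_point)
  let ?T = "pi1 (subtopology Y S) x"
  let ?\<tau> = "\<rho> \<circ> f \<circ> pi1_incl Y x"
  have \<rho>f: "\<rho> \<circ> f \<in> hom (pi1 Y x) SU2"
    using f(1) \<rho> by (rule hom_compose)
  have \<tau>: "?\<tau> \<in> hom ?T SU2"
    using pi1_incl_hom \<rho>f by (rule hom_compose)
  have "A ** B = B ** A" if AB: "A \<in> ?\<tau> ` carrier ?T" "B \<in> ?\<tau> ` carrier ?T" for A B
  proof -
    obtain a b where ab: "a \<in> carrier ?T" "b \<in> carrier ?T" and A: "A = ?\<tau> a" and B: "B = ?\<tau> b"
      using AB by blast
    obtain p q where p: "p \<in> loops (subtopology Y S) x" "a = loop_class (subtopology Y S) x p"
      and q: "q \<in> loops (subtopology Y S) x" "b = loop_class (subtopology Y S) x q"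
      using ab by (auto simp: carrier_pi1)
    have "a \<otimes>\<^bsub>?T\<^esub> b = b \<otimes>\<^bsub>?T\<^esub> a"
      using loop_class_eqI[OF loops_commute_of_homeomorphic_torus[OF torus p(1) q(1)]] p q
      by (simp add: pi1_mult_classes)
    then show ?thesis
      using hom_mult[OF \<tau> ab] hom_mult[OF \<tau> ab(2,1)] unfolding A B by simp
  qed
  moreover have "?\<tau> ` carrier ?T \<subseteq> carrier SU2"
    using \<tau> by (auto simp: hom_def)
  ultimately obtain P where P: "P \<in> carrier SU2"
    and diag: "\<And>A. A \<in> ?\<tau> ` carrier ?T \<Longrightarrow> conj_transpose P ** A ** P \<in> carrier U1"
    using commuting_SU2_simultaneously_diagonalizable by metis
  let ?\<sigma> = "\<lambda>a. conj_transpose P ** (\<rho> \<circ> f) a ** P"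
  have \<sigma>: "?\<sigma> \<in> hom (pi1 Y x) SU2"
    using \<rho>f P by (rule conj_hom_SU2)
  have "?\<sigma> (pi1_incl Y x a) \<in> carrier U1" if "a \<in> carrier ?T" for a
    using diag[of "?\<tau> a"] that by simp
  then have "?\<sigma> \<circ> pi1_incl Y x \<in> T_set (subtopology Y Z1) S x \<inter> T_set (subtopology Y Z2) S x"
    using S by (intro IntI T_set_restriction[OF \<sigma>])
  with \<sigma> have "abelian_image (pi1 Y x) ?\<sigma>"
    by (rule reps)
  with P have "abelian_image (pi1 Y x) (\<rho> \<circ> f)"
    by (rule abelian_image_conj)
  then show "abelian_image (pi1 Y y) \<rho>"
    unfolding abelian_image_def image_comp[symmetric] f(2) .
qed

section \<open>Gluing manifolds along their boundaries\<close>

lemma locally_path_connected_convex: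
  fixes M :: "'e::real_normed_vector set"
  assumes "convex M"
  shows "locally_path_connected_space (top_of_set M)"
  using convex_imp_locally_path_connected[OF assms]
  unfolding locally_path_connected_space_def neighbourhood_base_of locally_def
  by (simp add: path_connectedin_subtopology) (meson openin_imp_subset subset_trans)

text \<open>Convexity of the local model makes chart domains locally path connected; for the half-space this
  includes the points on the boundary.\<close>

lemma smooth_manifold_locally_path_connected:
  assumes atlas: "smooth_atlas M X \<A>" and M: "convex M"
  shows "locally_path_connected_space X"
  unfolding locally_path_connected_space
proof (intro allI impI)
  fix V x assume V: "openin X V \<and> x \<in> V"
  then have "x \<in> (\<Union>(U, c)\<in>\<A>. U)"
    using atlas openin_subset[of X V] by (auto simp: smooth_atlas_def)
  then obtain U c where Uc: "(U, c) \<in> \<A>" "x \<in> U"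
    by blast
  then have U: "openin X U" and cU: "openin (top_of_set M) (c ` U)"
    and c: "homeomorphic_map (subtopology X U) (top_of_set (c ` U)) c"
    using atlas by (auto simp: smooth_atlas_def)
  have "locally_path_connected_space (subtopology (top_of_set M) (c ` U))"
    using locally_path_connected_convex[OF M] cU by (rule locally_path_connected_space_open_subset)
  then have "locally_path_connected_space (top_of_set (c ` U))"
    using openin_imp_subset[OF cU] by (simp add: subtopology_subtopology Int_absorb1)
  then have "locally_path_connected_space (subtopology X U)"
    using homeomorphic_locally_path_connected_space[OF homeomorphic_map_imp_homeomorphic_space[OF c]]
    by simp
  moreover have "openin (subtopology X U) (V \<inter> U)" "x \<in> V \<inter> U"
    using V Uc by (auto simp: openin_subtopology_Int)
  ultimately obtain W where W: "openin (subtopology X U) W" "path_connectedin (subtopology X U) W"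
    "x \<in> W" "W \<subseteq> V \<inter> U"
    unfolding locally_path_connected_space by meson
  then show "\<exists>W. openin X W \<and> path_connectedin X W \<and> x \<in> W \<and> W \<subseteq> V"
    using U by (auto simp: path_connectedin_subtopology dest: openin_trans_full)
qed

lemma convex_half_space: "convex half_space"
  by (simp add: half_space_def convex_def)

lemma three_manifold_path_connected:
  assumes "three_manifold_with_torus_boundary X \<A>"
  shows "path_connected_space X"
  using assms smooth_manifold_locally_path_connected[OF _ convex_half_space]
    path_connected_eq_connected_space
  by (auto simp: three_manifold_with_torus_boundary_def smooth_manifold_def)

lemma bd_subset_topspace:
  assumes "three_manifold_with_torus_boundary X \<A>"
  shows "bd \<A> \<subseteq> topspace X"
proof -
  have "topspace X = (\<Union>(U, c)\<in>\<A>. U)"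
    using assms by (simp add: three_manifold_with_torus_boundary_def smooth_manifold_def smooth_atlas_def)
  then show ?thesis
    by (auto simp: bd_def)
qed

text \<open>The boundary, as defined by the charts, is closed by compactness: it is a torus in a Hausdorff
  space.\<close>

lemma closedin_bd:
  assumes X: "three_manifold_with_torus_boundary X \<A>"
  shows "closedin X (bd \<A>)"
proof -
  have "compact_space torus"
    unfolding torus_def compact_space_prod_topology
    by (intro disjI2 conjI compact_space_subtopology) (simp_all add: compactin_euclidean_iff)
  then have "compact_space (subtopology X (bd \<A>))"
    using X homeomorphic_compact_space
    by (auto simp: three_manifold_with_torus_boundary_def bd_space_def)
  then have "compactin X (bd \<A>)"
    using bd_subset_topspace[OF X] by (simp add: compactin_subspace)
  then show ?thesis
    using X by (auto simp: three_manifold_with_torus_boundary_def smooth_manifold_def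
        intro: compactin_imp_closedin)
qed

lemma diffeomorphism_imp_homeomorphic_map:
  "diffeomorphism X \<A> Y \<B> f \<Longrightarrow> homeomorphic_map X Y f"
  unfolding diffeomorphism_def smooth_map_def homeomorphic_map_maps homeomorphic_maps_def by blast

lemma path_connected_glue:
  assumes X: "path_connected_space X" and Z: "path_connected_space Z"
    and l: "continuous_map X (glue X B \<phi> Z) (glue_left B \<phi>)"
    and r: "continuous_map Z (glue X B \<phi> Z) (glue_right B \<phi>)"
    and meet: "b \<in> topspace X" "c \<in> topspace Z" "glue_left B \<phi> b = glue_right B \<phi> c"
  shows "path_connected_space (glue X B \<phi> Z)"
proof -
  have "path_connectedin (glue X B \<phi> Z) (glue_left B \<phi> ` topspace X \<union> glue_right B \<phi> ` topspace Z)"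
  proof (rule path_connectedin_Un)
    show "path_connectedin (glue X B \<phi> Z) (glue_left B \<phi> ` topspace X)"
      using l X by (intro path_connectedin_continuous_map_image) (auto simp: path_connectedin_topspace)
    show "path_connectedin (glue X B \<phi> Z) (glue_right B \<phi> ` topspace Z)"
      using r Z by (intro path_connectedin_continuous_map_image) (auto simp: path_connectedin_topspace)
  qed (use meet in blast)
  then show ?thesis
    by (simp add: path_connectedin_topspace flip: topspace_glue)
qed

theorem proposition3p3:
  fixes X1 :: "'a topology" and \<A>1 :: "('a, real^3) chart set"
    and X2 :: "'b topology" and \<A>2 :: "('b, real^3) chart set"
    and \<phi> :: "'a \<Rightarrow> 'b"
    and Y Y1 Y2 :: "('a + 'b) set topology" and \<Sigma> :: "('a + 'b) set set" and x :: "('a + 'b) set"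
  assumes "three_manifold_with_torus_boundary X1 \<A>1"
    and "three_manifold_with_torus_boundary X2 \<A>2"
    and "diffeomorphism (bd_space X1 \<A>1) (bd_atlas \<A>1) (bd_space X2 \<A>2) (bd_atlas \<A>2) \<phi>"
    and "Y = glue X1 (bd \<A>1) \<phi> X2"
    and "Y1 = subtopology Y (glue_left (bd \<A>1) \<phi> ` topspace X1)"
    and "Y2 = subtopology Y (glue_right (bd \<A>1) \<phi> ` topspace X2)"
    and "\<Sigma> = glue_left (bd \<A>1) \<phi> ` bd \<A>1"
    and "x \<in> \<Sigma>"
  shows "SU2_abelian Y \<longleftrightarrow>
    (\<forall>\<rho>\<in>hom (pi1 Y x) SU2.
       \<rho> \<circ> pi1_incl Y x \<in> T_set Y1 \<Sigma> x \<inter> T_set Y2 \<Sigma> x \<longrightarrow> abelian_image (pi1 Y x) \<rho>)"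
proof -
  let ?B = "bd \<A>1" and ?C = "bd \<A>2"
  let ?l = "glue_left ?B \<phi>" and ?r = "glue_right ?B \<phi>"
  have \<phi>: "homeomorphic_map (subtopology X1 ?B) (subtopology X2 ?C) \<phi>"
    using diffeomorphism_imp_homeomorphic_map[OF assms(3)] by (simp add: bd_space_def)
  have B: "?B \<subseteq> topspace X1" and C: "?C \<subseteq> topspace X2"
    using assms(1,2) by (auto dest: bd_subset_topspace)
  have inj: "inj_on \<phi> ?B" and im: "\<phi> ` ?B = ?C"
    using homeomorphic_imp_injective_map[OF \<phi>] homeomorphic_imp_surjective_map[OF \<phi>] B C
    by (simp_all add: Int_absorb1)
  have emb: "embedding_map X1 Y ?l" "embedding_map X2 Y ?r"
    unfolding assms(4) using embedding_map_glue[OF \<phi> closedin_bd[OF assms(1)] closedin_bd[OF assms(2)]] .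
  then have cont: "continuous_map X1 Y ?l" "continuous_map X2 Y ?r"
    by (auto simp: embedding_map_def dest: homeomorphic_imp_continuous_map continuous_map_into_fulltopology)
  obtain b where b: "b \<in> ?B" "x = ?l b"
    using assms(7,8) by blast
  have meet: "?l b' = ?r (\<phi> b')" "\<phi> b' \<in> topspace X2" if "b' \<in> ?B" for b'
    using glue_left_right[OF inj that] that im C by auto
  have \<Sigma>: "\<Sigma> \<subseteq> ?l ` topspace X1" "\<Sigma> \<subseteq> ?r ` topspace X2"
    unfolding assms(7) using B meet by auto
  have xY: "x \<in> topspace Y"
    using b B by (auto simp: assms(4) topspace_glue)
  have "homeomorphic_map X1 (subtopology Y (?l ` topspace X1)) ?l"
    using emb(1) by (simp add: embedding_map_def)
  then have "homeomorphic_map (subtopology X1 ?B) (subtopology (subtopology Y (?l ` topspace X1)) \<Sigma>) ?l"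
    using B continuous_map_image_subset_topspace[OF cont(1)]
    by (intro homeomorphic_map_subtopologies) (auto simp: assms(7))
  then have "subtopology X1 ?B homeomorphic_space subtopology Y \<Sigma>"
    using \<Sigma>(1) by (auto simp: subtopology_subtopology Int_absorb1 dest: homeomorphic_map_imp_homeomorphic_space)
  moreover have "subtopology X1 ?B homeomorphic_space torus"
    using assms(1) by (simp add: three_manifold_with_torus_boundary_def bd_space_def)
  ultimately have torus: "subtopology Y \<Sigma> homeomorphic_space torus"
    using homeomorphic_space_sym homeomorphic_space_trans by blast
  have Y: "path_connected_space Y"
    using assms(1,2) cont b B meet unfolding assms(4)
    by (intro path_connected_glue[of _ _ _ _ b "\<phi> b"]) (auto intro: three_manifold_path_connected)
  show ?thesis
  proof
    assume "SU2_abelian Y"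
    then show "\<forall>\<rho>\<in>hom (pi1 Y x) SU2.
       \<rho> \<circ> pi1_incl Y x \<in> T_set Y1 \<Sigma> x \<inter> T_set Y2 \<Sigma> x \<longrightarrow> abelian_image (pi1 Y x) \<rho>"
      using xY by (simp add: SU2_abelian_def)
  next
    assume "\<forall>\<rho>\<in>hom (pi1 Y x) SU2.
       \<rho> \<circ> pi1_incl Y x \<in> T_set Y1 \<Sigma> x \<inter> T_set Y2 \<Sigma> x \<longrightarrow> abelian_image (pi1 Y x) \<rho>"
    then show "SU2_abelian Y"
      unfolding assms(5,6)
      by (intro SU2_abelian_of_torus_reps_abelian[OF Y torus assms(8) xY \<Sigma>]) blast
  qed
qed

end
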